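(* Let $\mathbb{F}_q$ be a finite field with $q$ elements, let $n\ge1$, and let $N_0,\dots,N_{n-1}$ be nonnegative integers with $0\le\sum_{i=0}^{n-1}N_i\le q-1$. Put $m=q^n-\sum_{i=0}^{n-1}N_iq^i$. Then $$\frac{H_{m-1}}{\Gamma_{m}|_{\theta=t}}=\frac{(-1)^{\sum_{i=0}^{n-2}(n-1-i)N_iq^i}}{\prod_{i=0}^{n-2}\bigl(L_{n-1-i}|_{\theta=t}\bigr)^{N_iq^i}}\;\prod_{i=1}^{n-1}(t-\theta^{q^i})^{\sum_{j=0}^{n-1-i}N_jq^j}.$$
   Context: $\theta,t$ are independent variables over $\mathbb{F}_q$, $A=\mathbb{F}_q[\theta]$. For $k\ge1$ put $[k]=\theta^{q^k}-\theta$, $L_k=[k][k-1]\cdots[1]$, $D_0=1$, $D_k=\prod_{i=0}^{k-1}(\theta^{q^k}-\theta^{q^i})$. For $n=\sum_i n_iq^i$ ($0\le n_i\le q-1$) put $\Gamma_{n+1}=\prod_i D_i^{n_i}\in A$. For a polynomial $f$ in $\theta$, $f|_{\theta=t}$ denotes substitution of $t$ for $\theta$. Put $G_0=1$ and $G_i=\prod_{j=1}^i(t^{q^i}-\theta^{q^j})$ for $i\ge1$. The Anderson–Thakur polynomials $H_n\in A[t]$ are defined by $\bigl(1-\sum_{i\ge0}\frac{G_i}{D_i|_{\theta=t}}x^{q^i}\bigr)^{-1}=\sum_{n\ge0}\frac{H_n}{\Gamma_{n+1}|_{\theta=t}}x^n$. Empty sums are $0$ and empty products are $1$. *)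

theory Defs
  imports "HOL-Computational_Algebra.Computational_Algebra" "HOL-Library.Cardinality"
begin

text \<open>
  The field \<open>\<F>\<^sub>q\<close> is the type \<^typ>\<open>'a::finite_field\<close>, with \<open>q = CARD('a)\<close>. The ring
  \<open>A = \<F>\<^sub>q[\<theta>]\<close> is \<^typ>\<open>'a poly\<close> and \<open>A[t]\<close> is \<^typ>\<open>'a poly poly\<close>: the outer variable
  is \<open>t\<close>, and the elements of \<open>A\<close> are the constants of \<open>A[t]\<close>. Quotients live in \<open>Frac (A[t])\<close>.
\<close>

definition theta :: "'a::finite_field poly" where
  "theta = [:0, 1:]"

definition carlitz_bracket :: "nat \<Rightarrow> 'a::finite_field poly" where
  "carlitz_bracket k = theta ^ (CARD('a) ^ k) - theta"

definition carlitz_L :: "nat \<Rightarrow> 'a::finite_field poly" where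
  "carlitz_L k = (\<Prod>i=1..k. carlitz_bracket i)"

definition carlitz_D :: "nat \<Rightarrow> 'a::finite_field poly" where
  "carlitz_D k = (\<Prod>i<k. theta ^ (CARD('a) ^ k) - theta ^ (CARD('a) ^ i))"

text \<open>
  The argument is the index of \<open>\<Gamma>\<close>, so that \<open>carlitz_Gamma (n + 1)\<close> is formed from the base-\<open>q\<close>
  digits of \<open>n\<close>; the digits of \<open>n\<close> at positions beyond \<open>n\<close> vanish. Only positive indices are
  meaningful.
\<close>

definition carlitz_Gamma :: "nat \<Rightarrow> 'a::finite_field poly" where
  "carlitz_Gamma m = (\<Prod>i<m. carlitz_D i ^ ((m - 1) div CARD('a) ^ i mod CARD('a)))"

definition var_t :: "'a::finite_field poly poly" where
  "var_t = [:0, 1:]"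

text \<open>The substitution \<open>f|\<^bsub>\<theta>=t\<^esub>\<close> moves the coefficients of \<open>f\<close> to the outer variable.\<close>

definition subst_t :: "'a::finite_field poly \<Rightarrow> 'a poly poly" where
  "subst_t f = map_poly (\<lambda>c. [:c:]) f"

definition AT_G :: "nat \<Rightarrow> 'a::finite_field poly poly" where
  "AT_G i = (\<Prod>j=1..i. var_t ^ (CARD('a) ^ i) - [:theta ^ (CARD('a) ^ j):])"

text \<open>
  The series \<open>\<Sum>i\<ge>0. (G\<^sub>i / D\<^sub>i|\<^bsub>\<theta>=t\<^esub>) x ^ (q ^ i)\<close>. The exponents \<open>q ^ i\<close> are distinct, so each
  inner sum has at most one summand.
\<close>

definition AT_series :: "'a::finite_field poly poly fract fps" where
  "AT_series = Abs_fps (\<lambda>n. \<Sum>i | CARD('a) ^ i = n. to_fract (AT_G i) / to_fract (subst_t (carlitz_D i)))"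

text \<open>
  The family of Anderson--Thakur polynomials, as the unique sequence in \<open>A[t]\<close> with the given
  generating function; existence and uniqueness are proved in \<open>ex1_AT_H\<close> below.
\<close>

definition AT_H :: "nat \<Rightarrow> 'a::finite_field poly poly" where
  "AT_H = (THE H. inverse (1 - AT_series) =
                  Abs_fps (\<lambda>n. to_fract (H n) / to_fract (subst_t (carlitz_Gamma (n + 1)))))"


subsection \<open>Well-definedness of the Anderson--Thakur polynomials\<close>

lemma card_finite_field_ge_2: "CARD('a::finite_field) \<ge> 2"
proof -
  have "card {0, 1 :: 'a} \<le> CARD('a)"
    by (rule card_mono) auto
  thus ?thesis by simp
qed

lemma subst_t_1 [simp]: "subst_t 1 = 1"
  by (simp add: subst_t_def)

lemma subst_t_mult: "subst_t (f * g) = subst_t f * subst_t g"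
  by (rule poly_eqI) (simp add: subst_t_def coeff_map_poly coeff_mult sum_to_poly mult.commute)

lemma subst_t_eq_0_iff [simp]: "subst_t f = 0 \<longleftrightarrow> f = 0"
  by (simp add: subst_t_def map_poly_eq_0_iff)

lemma binomial_CARD_eq_0:
  assumes "0 < k" "k < CARD('a::finite_field)"
  shows   "of_nat (CARD('a) choose k) = (0 :: 'a)"
proof -
  define q where "q = CARD('a)"
  have q: "q \<ge> 2" using card_finite_field_ge_2[where 'a = 'a] by (simp add: q_def)
  define p :: "'a poly" where "p = (\<Sum>j\<in>{0<..<q}. monom (of_nat (q choose j)) j)"
  have "degree p \<le> q - 1"
    unfolding p_def by (rule degree_sum_le) (auto intro: order.trans[OF degree_monom_le])
  hence deg: "degree p < q" using q by linarith
  have roots: "poly p x = 0" for x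
  proof -
    have "x + 1 = (x + 1) ^ q"
      unfolding q_def by (simp add: finite_field_power_card_eq_same)
    also have "\<dots> = (\<Sum>j\<le>q. of_nat (q choose j) * x ^ j)"
      by (simp add: binomial_ring)
    also have "{..q} = insert 0 (insert q {0<..<q})"
      using q by auto
    also have "(\<Sum>j\<in>\<dots>. of_nat (q choose j) * x ^ j) = 1 + x ^ q + poly p x"
      using q by (simp add: p_def poly_sum poly_monom)
    also have "x ^ q = x"
      unfolding q_def by (simp add: finite_field_power_card_eq_same)
    finally show ?thesis by simp
  qed
  have "p = 0"
  proof (rule ccontr)
    assume "p \<noteq> 0"
    hence "card {x. poly p x = 0} \<le> degree p"
      by (rule card_poly_roots_bound)
    thus False using deg roots by (simp add: q_def)
  qed
  hence "coeff p k = 0" by simp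
  moreover have "coeff p k = of_nat (q choose k)"
    using assms by (simp add: p_def coeff_sum q_def)
  ultimately show ?thesis by (simp add: q_def)
qed

lemma poly_add_power_CARD:
  fixes x y :: "'a::finite_field poly"
  shows "(x + y) ^ CARD('a) = x ^ CARD('a) + y ^ CARD('a)"
proof -
  define q where "q = CARD('a)"
  have q: "q \<ge> 2" using card_finite_field_ge_2[where 'a = 'a] by (simp add: q_def)
  have "(x + y) ^ q = (\<Sum>j\<le>q. of_nat (q choose j) * x ^ j * y ^ (q - j))"
    by (rule binomial_ring)
  also have "\<dots> = (\<Sum>j\<in>{0,q}. of_nat (q choose j) * x ^ j * y ^ (q - j))"
    by (rule sum.mono_neutral_right)
       (auto simp: q_def of_nat_poly binomial_CARD_eq_0)
  also have "\<dots> = x ^ q + y ^ q"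
    using q by simp
  finally show ?thesis by (simp add: q_def)
qed

lemma poly_diff_power_CARD:
  fixes x y :: "'a::finite_field poly"
  shows "(x - y) ^ CARD('a) = x ^ CARD('a) - y ^ CARD('a)"
  using poly_add_power_CARD[of "x - y" y] by simp

lemma carlitz_D_Suc:
  "carlitz_D (Suc k) = carlitz_bracket (Suc k) * (carlitz_D k :: 'a::finite_field poly) ^ CARD('a)"
proof -
  have "(carlitz_D k :: 'a poly) ^ CARD('a) =
          (\<Prod>i<k. (theta ^ (CARD('a) ^ k) - theta ^ (CARD('a) ^ i)) ^ CARD('a))"
    by (simp add: carlitz_D_def prod_power_distrib)
  also have "\<dots> = (\<Prod>i<k. theta ^ (CARD('a) ^ Suc k) - theta ^ (CARD('a) ^ Suc i))"
    by (simp add: poly_diff_power_CARD power_mult [symmetric] mult.commute)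
  finally show ?thesis
    by (simp add: carlitz_D_def carlitz_bracket_def prod.lessThan_Suc_shift del: prod.lessThan_Suc)
qed

lemma theta_power_eq_iff: "(theta :: 'a::finite_field poly) ^ m = theta ^ n \<longleftrightarrow> m = n"
proof
  assume "(theta :: 'a poly) ^ m = theta ^ n"
  hence "degree ((theta :: 'a poly) ^ m) = degree ((theta :: 'a poly) ^ n)"
    by simp
  thus "m = n"
    by (simp add: theta_def degree_power_eq)
qed simp

lemma carlitz_D_nonzero [simp]: "carlitz_D k \<noteq> (0 :: 'a::finite_field poly)"
  using card_finite_field_ge_2[where 'a = 'a]
  by (auto simp: carlitz_D_def theta_power_eq_iff)

lemma carlitz_Gamma_nonzero [simp]: "carlitz_Gamma k \<noteq> (0 :: 'a::finite_field poly)"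
  by (simp add: carlitz_Gamma_def)

lemma digit_add_power:
  fixes q :: nat
  assumes q: "q \<ge> 2" and d: "Suc (k div q ^ i mod q) < q"
  shows   "(k + q ^ i) div q ^ j mod q = (if j = i then Suc (k div q ^ i mod q) else k div q ^ j mod q)"
proof -
  have pos: "q ^ i > 0" for i using q by simp
  consider "j < i" | "j = i" | "j > i" by linarith
  thus ?thesis
  proof cases
    case 1
    have "q ^ i = q ^ (i - j - 1 + 1 + j)"
      using 1 by simp
    also have "\<dots> = q ^ (i - j - 1) * q * q ^ j"
      by (simp only: power_add power_one_right)
    finally have "q ^ i = q ^ (i - j - 1) * q * q ^ j" .
    hence "(k + q ^ i) div q ^ j = k div q ^ j + q ^ (i - j - 1) * q"
      using pos[of j] by simp
    thus ?thesis using 1 by simp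
  next
    case 2
    have "(k + q ^ i) div q ^ i = Suc (k div q ^ i)"
      using pos[of i] by simp
    thus ?thesis using 2 d by (simp add: mod_Suc)
  next
    case 3
    have *: "q ^ j = q ^ i * (q * q ^ (j - i - 1))"
      using 3 by (simp flip: power_add power_Suc)
    have "(k + q ^ i) div q ^ j = Suc (k div q ^ i) div q div q ^ (j - i - 1)"
      unfolding * div_mult2_eq using pos[of i] by simp
    also have "Suc (k div q ^ i) div q = k div q ^ i div q"
      using d by (simp add: div_Suc mod_Suc)
    also have "\<dots> div q ^ (j - i - 1) = k div q ^ j"
      unfolding * div_mult2_eq ..
    finally show ?thesis using 3 by simp
  qed
qed

definition digit_prod :: "nat \<Rightarrow> nat \<Rightarrow> 'a::finite_field poly" where
  "digit_prod M k = (\<Prod>i<M. carlitz_D i ^ (k div CARD('a) ^ i mod CARD('a)))"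

lemma digit_prod_add:
  assumes "i < M" "Suc (k div CARD('a::finite_field) ^ i mod CARD('a)) < CARD('a)"
  shows   "digit_prod M (k + CARD('a) ^ i) = (digit_prod M k :: 'a poly) * carlitz_D i"
proof -
  have "(\<Prod>j\<in>{..<M} - {i}. carlitz_D j ^ ((k + CARD('a) ^ i) div CARD('a) ^ j mod CARD('a))) =
        (\<Prod>j\<in>{..<M} - {i}. (carlitz_D j :: 'a poly) ^ (k div CARD('a) ^ j mod CARD('a)))"
    using digit_add_power[OF card_finite_field_ge_2 assms(2)] by (intro prod.cong) auto
  thus ?thesis
    using digit_add_power[OF card_finite_field_ge_2 assms(2), of i] assms(1)
    by (simp add: digit_prod_def prod.remove[of "{..<M}" i] mult_ac)
qed

lemma digit_prod_add_mult:
  assumes "i < M" "k div CARD('a::finite_field) ^ i mod CARD('a) = 0" "c < CARD('a)"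
  shows   "digit_prod M (k + c * CARD('a) ^ i) = (digit_prod M k :: 'a poly) * carlitz_D i ^ c"
  using assms(3)
proof (induction c)
  case (Suc c)
  have "(k + c * CARD('a) ^ i) div CARD('a) ^ i mod CARD('a) = (k div CARD('a) ^ i + c) mod CARD('a)"
    by (simp add: add.commute)
  also have "\<dots> = c"
    using Suc.prems assms(2) by (metis Suc_lessD add_0 mod_add_left_eq mod_less)
  finally have d: "(k + c * CARD('a) ^ i) div CARD('a) ^ i mod CARD('a) = c" .
  have "k + Suc c * CARD('a) ^ i = (k + c * CARD('a) ^ i) + CARD('a) ^ i" by simp
  also have "digit_prod M \<dots> = (digit_prod M (k + c * CARD('a) ^ i) :: 'a poly) * carlitz_D i"
    using d Suc.prems assms(1) by (intro digit_prod_add) simp_all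
  finally show ?case using Suc by (simp add: mult_ac)
qed simp

lemma digit_prod_dvd:
  assumes "i \<le> M" "k + CARD('a::finite_field) ^ i < CARD('a) ^ M"
  shows   "(digit_prod M k :: 'a poly) * carlitz_D i dvd digit_prod M (k + CARD('a) ^ i)"
  using assms
proof (induction arbitrary: k rule: inc_induct)
  case base
  thus ?case by simp
next
  case (step i)
  define q where "q = CARD('a)"
  have q: "q \<ge> 2" using card_finite_field_ge_2[where 'a = 'a] by (simp add: q_def)
  define d where "d = k div q ^ i mod q"
  have "d < q" using q by (simp add: d_def)
  show ?case
  proof (cases "Suc d < q")
    case True
    thus ?thesis
      using digit_prod_add[of i M k, where 'a = 'a] step by (simp add: d_def q_def)
  next
    case False
    hence dq: "d = q - 1" using \<open>d < q\<close> by simp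
    have "d * q ^ i \<le> k"
    proof -
      have "d * q ^ i \<le> k div q ^ i * q ^ i"
        unfolding d_def by (intro mult_right_mono) auto
      also have "\<dots> \<le> k" by simp
      finally show ?thesis .
    qed
    define k' where "k' = k - d * q ^ i"
    have k: "k = k' + d * q ^ i" using \<open>d * q ^ i \<le> k\<close> by (simp add: k'_def)
    have "k div q ^ i = k' div q ^ i + d"
      using q by (subst k) simp
    hence "k' div q ^ i = k div q ^ i - d" by simp
    also have "\<dots> mod q = 0"
      by (simp add: d_def minus_mod_eq_mult_div)
    finally have d': "k' div q ^ i mod q = 0" .
    have sum_eq: "k + q ^ i = k' + q ^ Suc i"
    proof -
      have "k + q ^ i = k' + (d + 1) * q ^ i" by (subst k) simp
      also have "d + 1 = q" using dq q by simp
      finally show ?thesis by simp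
    qed
    have "digit_prod M k * carlitz_D i = (digit_prod M k' :: 'a poly) * carlitz_D i ^ q"
    proof -
      have "digit_prod M k = (digit_prod M k' :: 'a poly) * carlitz_D i ^ d"
        using digit_prod_add_mult[of i M k' d, where 'a = 'a] step d' \<open>d < q\<close> k by (simp add: q_def)
      moreover have "carlitz_D i ^ d * carlitz_D i = (carlitz_D i :: 'a poly) ^ q"
        using dq q by (simp flip: power_Suc2)
      ultimately show ?thesis by (simp add: mult.assoc)
    qed
    also have "\<dots> dvd digit_prod M k' * carlitz_D (Suc i)"
      by (intro mult_dvd_mono) (simp_all add: carlitz_D_Suc q_def)
    also have "\<dots> dvd digit_prod M (k' + CARD('a) ^ Suc i)"
      using step.prems sum_eq by (intro step.IH) (simp add: q_def)
    finally show ?thesis using sum_eq by (simp add: q_def)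
  qed
qed

lemma carlitz_Gamma_eq_digit_prod:
  assumes "n < M"
  shows   "carlitz_Gamma (Suc n) = (digit_prod M n :: 'a::finite_field poly)"
proof -
  have "n div CARD('a) ^ i = 0" if "i > n" for i
  proof -
    have "n < 2 ^ i" using that less_exp[of i] by linarith
    also have "(2 :: nat) ^ i \<le> CARD('a) ^ i"
      using card_finite_field_ge_2 by (intro power_mono) auto
    finally show ?thesis by simp
  qed
  thus ?thesis
    unfolding carlitz_Gamma_def digit_prod_def diff_Suc_1 using assms
    by (intro prod.mono_neutral_left) auto
qed

lemma carlitz_Gamma_dvd:
  "carlitz_Gamma (Suc k) * (carlitz_D i :: 'a::finite_field poly) dvd
   carlitz_Gamma (Suc (k + CARD('a) ^ i))"
proof -
  define M where "M = Suc (k + CARD('a) ^ i)"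
  have less: "n < CARD('a) ^ n" for n
    using card_finite_field_ge_2[where 'a = 'a] by (intro power_gt_expt) auto
  have "i \<le> M" using less[of i] by (simp add: M_def)
  moreover have "k + CARD('a) ^ i < CARD('a) ^ M"
    using less[of M] by (simp add: M_def)
  ultimately have "(digit_prod M k :: 'a poly) * carlitz_D i dvd digit_prod M (k + CARD('a) ^ i)"
    by (rule digit_prod_dvd)
  thus ?thesis
    by (simp add: carlitz_Gamma_eq_digit_prod[of _ M] M_def)
qed

lemma to_fract_sum: "to_fract (sum f A) = (\<Sum>x\<in>A. to_fract (f x))"
  by (induction A rule: infinite_finite_induct) auto

lemma AT_integral:
  "to_fract (subst_t (carlitz_Gamma (Suc n))) * fps_nth (inverse (1 - AT_series)) n
     \<in> range (to_fract :: 'a::finite_field poly poly \<Rightarrow> _)"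
proof (induction n rule: less_induct)
  case (less n)
  define a :: "'a poly poly fract fps" where "a = inverse (1 - AT_series)"
  define g :: "nat \<Rightarrow> 'a poly poly fract"
    where "g n = to_fract (subst_t (carlitz_Gamma (Suc n)))" for n
  define R :: "'a poly poly fract set" where "R = range to_fract"
  have R_sum: "sum f A \<in> R" if "\<And>x. x \<in> A \<Longrightarrow> f x \<in> R" for f :: "nat \<Rightarrow> _" and A
  proof -
    have "\<forall>x\<in>A. \<exists>y. f x = to_fract y" using that by (auto simp: R_def)
    then obtain h where "\<And>x. x \<in> A \<Longrightarrow> f x = to_fract (h x)" by metis
    hence "sum f A = to_fract (sum h A)" by (simp add: to_fract_sum)
    thus ?thesis unfolding R_def by (rule range_eqI)
  qed
  have R_add: "x + y \<in> R" if "x \<in> R" "y \<in> R" for x y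
    using that by (auto simp: R_def simp flip: to_fract_add)
  have R_mult: "x * y \<in> R" if "x \<in> R" "y \<in> R" for x y
    using that by (auto simp: R_def simp flip: to_fract_mult)
  have S0: "fps_nth (AT_series :: 'a poly poly fract fps) 0 = 0"
    by (simp add: AT_series_def)
  have "a * (1 - AT_series) = 1"
    unfolding a_def by (rule inverse_mult_eq_1) (simp add: S0)
  hence "a = 1 + a * AT_series" by (simp add: algebra_simps)
  hence "fps_nth a n = fps_nth (1 + a * AT_series) n" by simp
  also have "\<dots> = (if n = 0 then 1 else 0) + (\<Sum>k=0..n. fps_nth a k * fps_nth AT_series (n - k))"
    by (simp add: fps_mult_nth)
  finally have "g n * fps_nth a n = g n * (if n = 0 then 1 else 0) +
                   (\<Sum>k=0..n. g n * (fps_nth a k * fps_nth AT_series (n - k)))"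
    by (simp add: ring_distribs sum_distrib_left)
  also have "\<dots> \<in> R"
  proof (intro R_add R_sum)
    show "g n * (if n = 0 then 1 else 0) \<in> R"
      by (auto simp: g_def R_def intro: range_eqI[of _ _ 0])
  next
    fix k assume "k \<in> {0..n}"
    show "g n * (fps_nth a k * fps_nth AT_series (n - k)) \<in> R"
    proof (cases "k = n")
      case True
      thus ?thesis by (auto simp: S0 R_def intro: range_eqI[of _ _ 0])
    next
      case False
      hence "k < n" using \<open>k \<in> {0..n}\<close> by simp
      have "g n * (fps_nth a k * fps_nth AT_series (n - k)) =
            (\<Sum>i | CARD('a) ^ i = n - k. g n * (fps_nth a k * (to_fract (AT_G i) / to_fract (subst_t (carlitz_D i)))))"
        by (simp add: AT_series_def sum_distrib_left)
      also have "\<dots> \<in> R"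
      proof (rule R_sum)
        fix i assume "i \<in> {i. CARD('a) ^ i = n - k}"
        hence n: "n = k + CARD('a) ^ i" using \<open>k < n\<close> by simp
        obtain r :: "'a poly" where r: "carlitz_Gamma (Suc n) = carlitz_Gamma (Suc k) * carlitz_D i * r"
          using carlitz_Gamma_dvd[of k i, where 'a = 'a] unfolding n by (auto elim: dvdE)
        have "g n * (fps_nth a k * (to_fract (AT_G i) / to_fract (subst_t (carlitz_D i)))) =
              (g k * fps_nth a k) * to_fract (subst_t r * AT_G i)"
          unfolding g_def r by (simp add: subst_t_mult)
        also have "\<dots> \<in> R"
        proof (rule R_mult)
          show "g k * fps_nth a k \<in> R"
            using less.IH[OF \<open>k < n\<close>] unfolding g_def a_def R_def .
        qed (unfold R_def, rule rangeI)
        finally show "g n * (fps_nth a k * (to_fract (AT_G i) / to_fract (subst_t (carlitz_D i)))) \<in> R" .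
      qed
      finally show ?thesis .
    qed
  qed
  finally show ?case by (simp add: g_def a_def R_def)
qed

theorem ex1_AT_H:
  "\<exists>!H :: nat \<Rightarrow> 'a::finite_field poly poly. inverse (1 - AT_series) =
     Abs_fps (\<lambda>n. to_fract (H n) / to_fract (subst_t (carlitz_Gamma (n + 1))))"
proof -
  have "\<forall>n. \<exists>h :: 'a poly poly.
          to_fract (subst_t (carlitz_Gamma (Suc n))) * fps_nth (inverse (1 - AT_series)) n = to_fract h"
    using AT_integral by blast
  then obtain H :: "nat \<Rightarrow> 'a poly poly" where
    "\<And>n. to_fract (subst_t (carlitz_Gamma (Suc n))) * fps_nth (inverse (1 - AT_series)) n = to_fract (H n)"
    by metis
  hence ex: "inverse (1 - AT_series) =
           Abs_fps (\<lambda>n. to_fract (H n) / to_fract (subst_t (carlitz_Gamma (n + 1))))"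
    by (intro fps_ext) (simp add: field_simps)
  have uniq: "H = H'"
    if "Abs_fps (\<lambda>n. to_fract (H n) / to_fract (subst_t (carlitz_Gamma (n + 1)))) =
        Abs_fps (\<lambda>n. to_fract (H' n) / to_fract (subst_t (carlitz_Gamma (n + 1))))"
    for H H' :: "nat \<Rightarrow> 'a poly poly"
  proof
    fix n
    show "H n = H' n"
      using arg_cong[OF that, of "\<lambda>f. fps_nth f n"] by simp
  qed
  show ?thesis
    by (rule ex1I[of _ H], rule ex, rule uniq) (simp only: ex)
qed

theorem AT_H_generating_function:
  "inverse (1 - AT_series) =
     Abs_fps (\<lambda>n. to_fract (AT_H n :: 'a::finite_field poly poly) /
                   to_fract (subst_t (carlitz_Gamma (n + 1))))"
  unfolding AT_H_def by (rule theI'[OF ex1_AT_H])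

end

theory Submission
  imports Defs
begin

text \<open>
  Let \<open>S(x) = \<Sum>i\<ge>0. a\<^sub>i x ^ (q ^ i)\<close> be the series with \<open>\<Sum>H\<^sub>n x\<^sup>n / \<Gamma> = 1 / (1 - S)\<close>, and let \<open>\<lambda>\<close> be its
  compositional inverse, with coefficient \<open>\<lambda>\<^sub>i\<close> at \<open>y ^ (q ^ i)\<close>. Comparing base-\<open>q\<close> digit sums shows that the coefficient of
  \<open>x ^ (q\<^sup>n - 1)\<close> in \<open>S\<^sup>d\<close> is \<open>1\<close> for \<open>d = q\<^sup>n - 1\<close> and \<open>0\<close> otherwise; hence \<open>f(S)\<close> and \<open>f\<close> have the
  same coefficient of index \<open>q\<^sup>n - 1\<close>, for every power series \<open>f\<close>. With \<open>E = \<Sum>i<n. N\<^sub>i q\<^sup>i\<close> and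
  \<open>f = \<lambda>\<^sup>E / (1 - y)\<close>, so that \<open>f(S) = x\<^sup>E / (1 - S)\<close>, the required coefficient is the sum of the
  coefficients of \<open>\<lambda>\<^sup>E\<close> of index below \<open>q\<^sup>n\<close>. Since \<open>\<Sum>N\<^sub>i < q\<close>, this range keeps exactly the
  products of terms of \<open>\<lambda>\<close> in which no factor reaches \<open>y ^ (q\<^sup>n)\<close>, so the sum is the product over \<open>i\<close>
  of the powers \<open>N\<^sub>i q\<^sup>i\<close> of \<open>\<lambda>\<^sub>0 + \<dots> + \<lambda>\<^sub>n\<^sub>-\<^sub>1\<^sub>-\<^sub>i\<close>. Finally
  \<open>\<lambda>\<^sub>0 + \<dots> + \<lambda>\<^sub>k = \<Prod>j=1..k. (t - \<theta> ^ (q ^ j)) / (t - t ^ (q ^ j))\<close>, by a telescoping identity.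
\<close>

section \<open>Base-\<open>q\<close> digit sums\<close>

function digit_sum :: "nat \<Rightarrow> nat \<Rightarrow> nat" where
  "digit_sum q k = (if q < 2 \<or> k = 0 then 0 else k mod q + digit_sum q (k div q))"
  by auto
termination by (relation "measure snd") auto

declare digit_sum.simps [simp del]

lemma digit_sum_0 [simp]: "digit_sum q 0 = 0"
  by (simp add: digit_sum.simps)

lemma digit_sum_mult_add:
  assumes "r < q" "2 \<le> q"
  shows   "digit_sum q (q * k + r) = digit_sum q k + r"
proof (cases "q * k + r = 0")
  case False
  thus ?thesis using assms by (subst digit_sum.simps) simp
qed (use assms in auto)

text \<open>Below \<open>q - 1\<close> only the last digit grows; a last digit \<open>q - 1\<close>
  becomes \<open>0\<close> and the carry increments the smaller number \<open>k div q\<close>, where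
  the induction hypothesis applies.\<close>

lemma digit_sum_Suc_le:
  assumes q: "2 \<le> q"
  shows   "digit_sum q (Suc k) \<le> Suc (digit_sum q k)"
proof (induction k rule: less_induct)
  case (less k)
  define k' r where "k' = k div q" and "r = k mod q"
  have k: "k = q * k' + r" and r: "r < q" using q by (auto simp: k'_def r_def)
  show ?case
  proof (cases "Suc r < q")
    case True
    thus ?thesis using digit_sum_mult_add[of "Suc r" q k'] digit_sum_mult_add[of r q k'] q k by simp
  next
    case False
    hence rq: "Suc r = q" using r by simp
    hence "Suc k = q * Suc k' + 0" by (simp add: k)
    hence "digit_sum q (Suc k) = digit_sum q (Suc k')"
      using digit_sum_mult_add[of 0 q "Suc k'"] q by simp
    moreover have "k' < k"
    proof -
      have "2 * k' \<le> q * k'" using q by simp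
      thus ?thesis using k rq q by linarith
    qed
    ultimately show ?thesis
      using less.IH[of k'] digit_sum_mult_add[OF r q, of k'] k by simp
  qed
qed

text \<open>Stripping the last digit turns the addition of \<open>q ^ Suc i\<close> into that of
  \<open>q ^ i\<close>, down to a successor step.\<close>

lemma digit_sum_add_power_le:
  assumes q: "2 \<le> q"
  shows   "digit_sum q (k + q ^ i) \<le> Suc (digit_sum q k)"
proof (induction i arbitrary: k)
  case 0
  thus ?case using digit_sum_Suc_le[OF q] by simp
next
  case (Suc i)
  define k' r where "k' = k div q" and "r = k mod q"
  have k: "k = q * k' + r" and r: "r < q" using q by (auto simp: k'_def r_def)
  have "digit_sum q (k + q ^ Suc i) = digit_sum q (q * (k' + q ^ i) + r)"
    by (simp add: k algebra_simps)
  thus ?case using digit_sum_mult_add[OF r q] Suc[of k'] k by simp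
qed

lemma digit_sum_power_minus_1:
  assumes q: "2 \<le> q"
  shows   "digit_sum q (q ^ n - 1) = n * (q - 1)"
proof (induction n)
  case (Suc n)
  have "q ^ n > 0" using q by simp
  hence "q * q ^ n \<ge> q" by simp
  hence "q ^ Suc n - 1 = q * (q ^ n - 1) + (q - 1)"
    using q by (simp add: algebra_simps)
  hence "digit_sum q (q ^ Suc n - 1) = n * (q - 1) + (q - 1)"
    using digit_sum_mult_add[of "q - 1" q "q ^ n - 1"] Suc q by (simp del: power_Suc)
  thus ?case by (simp only: mult_Suc add.commute)
qed simp

text \<open>All \<open>n\<close> digits of \<open>q ^ n - 1\<close> are \<open>q - 1\<close>, so for
  a smaller number either the last digit or the remaining part falls short.\<close>

lemma digit_sum_less:
  assumes q: "2 \<le> q"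
  shows   "d < q ^ n - 1 \<Longrightarrow> digit_sum q d < n * (q - 1)"
proof (induction n arbitrary: d)
  case (Suc n)
  define k r where "k = d div q" and "r = d mod q"
  have d: "d = q * k + r" and r: "r < q" using q by (auto simp: k_def r_def)
  have pos: "q ^ n > 0" using q by simp
  have "d < q * q ^ n" using Suc.prems by simp
  hence "k < q ^ n" unfolding k_def by (simp add: div_less_iff_less_mult mult.commute q less_mult_imp_div_less)
  show ?case
  proof (cases "k = q ^ n - 1")
    case True
    have "q ^ Suc n - 1 = q * k + (q - 1)"
      using q pos True by (simp add: algebra_simps)
    hence "r < q - 1" using Suc.prems d by linarith
    moreover have "digit_sum q d = n * (q - 1) + r"
      using True digit_sum_power_minus_1[OF q, of n] digit_sum_mult_add[OF r q, of k] d by simp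
    ultimately show ?thesis by (simp only: mult_Suc)
  next
    case False
    hence "digit_sum q k < n * (q - 1)" using \<open>k < q ^ n\<close> by (intro Suc.IH) simp
    thus ?thesis using digit_sum_mult_add[OF r q, of k] d r by simp
  qed
qed simp

section \<open>Additive power series, supported on the exponents \<open>q ^ i\<close>\<close>

definition qlin_series :: "nat \<Rightarrow> (nat \<Rightarrow> 'b) \<Rightarrow> 'b::comm_ring_1 fps" where
  "qlin_series q a = Abs_fps (\<lambda>k. \<Sum>i | q ^ i = k. a i)"

lemma qlin_series_nth_power [simp]:
  assumes "2 \<le> q"
  shows   "qlin_series q a $ (q ^ i) = a i"
proof -
  have "{j. q ^ j = q ^ i} = {i}" using assms by auto
  thus ?thesis by (simp add: qlin_series_def)
qed

lemma qlin_series_nth_eq_0: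
  assumes "k \<notin> range (\<lambda>i. q ^ i)"
  shows   "qlin_series q a $ k = 0"
proof -
  have "{i. q ^ i = k} = {}" using assms by auto
  thus ?thesis by (simp add: qlin_series_def)
qed

lemma qlin_series_nth_0 [simp]: "2 \<le> q \<Longrightarrow> qlin_series q a $ 0 = 0"
  by (rule qlin_series_nth_eq_0) auto

text \<open>Congruence modulo \<open>x ^ M\<close> respects products; with its versions for powers
  and finite products it lets a series be replaced by a polynomial truncation.\<close>

lemma fps_mult_nth_cong:
  assumes "\<And>k. k < M \<Longrightarrow> f $ k = f' $ k" "\<And>k. k < M \<Longrightarrow> g $ k = g' $ k" "k < M"
  shows   "(f * g :: 'b::comm_ring_1 fps) $ k = (f' * g') $ k"
  using assms by (simp add: fps_mult_nth)

lemma fps_power_nth_cong: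
  assumes "\<And>k. k < M \<Longrightarrow> f $ k = f' $ k" "k < M"
  shows   "(f ^ n :: 'b::comm_ring_1 fps) $ k = (f' ^ n) $ k"
  using assms(2)
proof (induction n arbitrary: k)
  case (Suc n)
  show ?case unfolding power_Suc by (rule fps_mult_nth_cong[OF assms(1) Suc.IH Suc.prems])
qed simp

lemma fps_prod_nth_cong:
  assumes "\<And>i k. i \<in> A \<Longrightarrow> k < M \<Longrightarrow> f i $ k = f' i $ k" "k < M"
  shows   "(prod f A :: 'b::comm_ring_1 fps) $ k = prod f' A $ k"
  using assms
proof (induction A arbitrary: k rule: infinite_finite_induct)
  case (insert x A)
  have "(f x * prod f A) $ k = (f' x * prod f' A) $ k"
    by (rule fps_mult_nth_cong[where M = M]) (use insert in auto)
  thus ?case using insert by simp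
qed auto

lemma fps_mult_inverse_one_minus_X_nth:
  "(f * inverse (1 - fps_X) :: 'b::field fps) $ k = (\<Sum>i\<le>k. f $ i)"
proof -
  have "inverse (1 - fps_X) = Abs_fps (\<lambda>_. 1::'b)"
    by (subst fps_inverse_one_minus_fps_X) auto
  thus ?thesis by (simp add: fps_mult_nth atLeast0AtMost)
qed

section \<open>The Frobenius map on a field and on its power series\<close>

lemma frobenius_add:
  fixes x y :: "'b::comm_ring_1"
  assumes "0 < q" and "\<And>k. 0 < k \<Longrightarrow> k < q \<Longrightarrow> of_nat (q choose k) = (0 :: 'b)"
  shows   "(x + y) ^ q = x ^ q + y ^ q"
proof -
  have "(x + y) ^ q = (\<Sum>j\<le>q. of_nat (q choose j) * x ^ j * y ^ (q - j))"
    by (rule binomial_ring)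
  also have "\<dots> = (\<Sum>j\<in>{0,q}. of_nat (q choose j) * x ^ j * y ^ (q - j))"
    by (rule sum.mono_neutral_right) (auto simp: assms)
  also have "\<dots> = x ^ q + y ^ q"
    using assms(1) by simp
  finally show ?thesis .
qed

text \<open>The binomial condition makes \<open>x \<mapsto> x ^ q\<close> additive on the field. The
  instance in view is the fraction field of \<open>A[t]\<close> with
  \<open>q = CARD('a)\<close>.\<close>

locale frobenius_field =
  fixes q :: nat and K :: "'b::field itself"
  assumes q_ge_2: "2 \<le> q"
    and binomial_eq_0: "0 < k \<Longrightarrow> k < q \<Longrightarrow> of_nat (q choose k) = (0 :: 'b)"
begin

lemma add_power_q: "(x + y :: 'b) ^ q = x ^ q + y ^ q"
  using q_ge_2 binomial_eq_0 by (intro frobenius_add) auto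

lemma diff_power_q_power: "(x - y :: 'b) ^ (q ^ i) = x ^ (q ^ i) - y ^ (q ^ i)"
proof (induction i)
  case (Suc i)
  have "(x - y) ^ (q ^ Suc i) = (x ^ (q ^ i) - y ^ (q ^ i)) ^ q"
    by (simp only: power_Suc2 power_mult Suc)
  moreover have "(u - v) ^ q = u ^ q - v ^ q" for u v :: 'b
    using add_power_q[of "u - v" v] by simp
  ultimately show ?case by (simp add: mult.commute flip: power_mult)
qed simp

lemma sum_power_q_power: "(sum f A :: 'b) ^ (q ^ i) = (\<Sum>x\<in>A. f x ^ (q ^ i))"
proof (induction A rule: infinite_finite_induct)
  case (insert x A)
  thus ?case using diff_power_q_power[of "f x + sum f A" "sum f A" i] by simp
qed (use q_ge_2 in auto)

lemma fps_add_power_q: "(f + g :: 'b fps) ^ q = f ^ q + g ^ q"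
proof (rule frobenius_add)
  fix k assume "0 < k" "k < q"
  have "(of_nat (q choose k) :: 'b fps) = fps_const (of_nat (q choose k))"
    by (simp only: fps_of_nat)
  also have "\<dots> = 0" using binomial_eq_0[OF \<open>0 < k\<close> \<open>k < q\<close>] by simp
  finally show "(of_nat (q choose k) :: 'b fps) = 0" .
qed (use q_ge_2 in auto)

lemma fps_power_q_nth:
  "(f ^ q :: 'b fps) $ k = (if q dvd k then (f $ (k div q)) ^ q else 0)"
proof -
  \<comment> \<open>\<open>P\<close> is \<open>f\<close> truncated after degree \<open>k\<close>: a
    finite sum, to which additivity of the Frobenius applies, with the same coefficient of index
    \<open>k\<close> in its power \<open>q\<close>.\<close>
  define P where "P = (\<Sum>i\<le>k. fps_const (f $ i) * fps_X ^ i)"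
  have P: "P $ j = f $ j" if "j < Suc k" for j
  proof -
    have "P $ j = (\<Sum>i\<le>k. if i = j then f $ i else 0)"
      unfolding P_def by (simp add: fps_sum_nth fps_mult_right_const_nth if_distrib cong: if_cong)
    thus ?thesis using that by simp
  qed
  have sum_pow: "(sum h A) ^ q = (\<Sum>i\<in>A. h i ^ q)" if "finite A" for h :: "nat \<Rightarrow> 'b fps" and A
    using that by (induction A rule: finite_induct) (use q_ge_2 in \<open>auto simp: fps_add_power_q\<close>)
  have "(f ^ q) $ k = (P ^ q) $ k"
    by (rule fps_power_nth_cong[where M = "Suc k"]) (use P in auto)
  also have "P ^ q = (\<Sum>i\<le>k. fps_const ((f $ i) ^ q) * fps_X ^ (q * i))"
    unfolding P_def by (simp add: sum_pow power_mult_distrib fps_const_power mult.commute flip: power_mult)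
  also have "\<dots> $ k = (\<Sum>i\<le>k. if q * i = k then (f $ i) ^ q else 0)"
    by (auto simp: fps_sum_nth intro!: sum.cong)
  also have "\<dots> = (if q dvd k then (f $ (k div q)) ^ q else 0)"
  proof (cases "q dvd k")
    case True
    then obtain m where k: "k = q * m" by blast
    hence "(\<Sum>i\<le>k. if q * i = k then (f $ i) ^ q else 0) = (\<Sum>i\<le>k. if i = m then (f $ i) ^ q else 0)"
      using q_ge_2 by (intro sum.cong) auto
    also have "m \<le> k" using q_ge_2 k by simp
    hence "(\<Sum>i\<le>k. if i = m then (f $ i) ^ q else 0) = (f $ m) ^ q" by simp
    finally show ?thesis using k q_ge_2 by simp
  next
    case False
    hence "\<And>i. q * i \<noteq> k" by auto
    thus ?thesis using False by simp
  qed
  finally show ?thesis .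
qed

text \<open>The Frobenius acts term by term and multiplies exponents by \<open>q\<close>, so
  \<open>i\<close> applications shift the coefficient sequence by \<open>i\<close> places; the zeros
  fill the vacated places.\<close>

lemma qlin_series_power_q_power:
  "(qlin_series q a :: 'b fps) ^ (q ^ i) = qlin_series q (\<lambda>j. if j < i then 0 else a (j - i) ^ (q ^ i))"
proof (induction i)
  case (Suc i)
  define b where "b = (\<lambda>j. if j < i then 0 else a (j - i) ^ (q ^ i))"
  have "qlin_series q a ^ (q ^ Suc i) = (qlin_series q b) ^ q"
    by (simp only: power_Suc2 power_mult Suc b_def)
  also have "\<dots> = qlin_series q (\<lambda>j. if j < Suc i then 0 else a (j - Suc i) ^ (q ^ Suc i))"
    (is "_ = qlin_series q ?c")
  proof (rule fps_ext)
    fix k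
    show "(qlin_series q b ^ q) $ k = qlin_series q ?c $ k"
    proof (cases "k \<in> range (\<lambda>i. q ^ i)")
      case True
      then obtain j where k: "k = q ^ j" by auto
      show ?thesis
      proof (cases j)
        case 0
        thus ?thesis using q_ge_2 qlin_series_nth_power[OF q_ge_2, of ?c 0] by (simp add: k fps_power_q_nth)
      next
        case (Suc j')
        thus ?thesis using q_ge_2 qlin_series_nth_power[OF q_ge_2, of ?c "Suc j'"]
          by (auto simp: k fps_power_q_nth b_def mult.commute simp flip: power_mult)
      qed
    next
      case False
      have "(k div q) \<notin> range (\<lambda>i. q ^ i)" if "q dvd k"
      proof
        assume "k div q \<in> range (\<lambda>i. q ^ i)"
        then obtain j where "k div q = q ^ j" by auto
        hence "k = q ^ Suc j" using that by (metis dvd_div_mult_self power_Suc2)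
        thus False using False by blast
      qed
      thus ?thesis using False q_ge_2
        by (auto simp: fps_power_q_nth qlin_series_nth_eq_0)
    qed
  qed
  finally show ?case .
qed simp

text \<open>With \<open>d = q * d' + r\<close>, the power \<open>d\<close> of the series is the
  Frobenius image of the power \<open>d'\<close> times \<open>r\<close> further factors. The
  Frobenius appends a digit \<open>0\<close> to exponents, and each further factor adds some
  \<open>q ^ j\<close>, hence at most \<open>1\<close> to the digit sum.\<close>

lemma digit_sum_le_of_qlin_series_power_nth:
  assumes "((qlin_series q a :: 'b fps) ^ d) $ k \<noteq> 0"
  shows   "digit_sum q k \<le> digit_sum q d"
  using assms
proof (induction d arbitrary: k rule: less_induct)
  case (less d)
  define S where "S = (qlin_series q a :: 'b fps)"
  define d' r where "d' = d div q" and "r = d mod q"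
  have d: "d = q * d' + r" and r: "r < q" using q_ge_2 by (auto simp: d'_def r_def)
  have step: "digit_sum q k \<le> B + s"
    if "\<And>k. f $ k \<noteq> 0 \<Longrightarrow> digit_sum q k \<le> B" "(f * S ^ s) $ k \<noteq> 0" for f B s k
    using that(2)
  proof (induction s arbitrary: k)
    case (Suc s)
    have "(f * S ^ Suc s) $ k = (\<Sum>i=0..k. (f * S ^ s) $ i * S $ (k - i))"
      unfolding power_Suc2 mult.assoc [symmetric] by (rule fps_mult_nth)
    with Suc.prems obtain i where i: "i \<le> k" "(f * S ^ s) $ i \<noteq> 0" "S $ (k - i) \<noteq> 0"
      by (metis (no_types, lifting) atLeastAtMost_iff mult_not_zero sum.neutral)
    obtain j where "k - i = q ^ j"
      using i(3) qlin_series_nth_eq_0[of "k - i" q a] unfolding S_def by blast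
    hence "k = i + q ^ j" using i(1) by simp
    thus ?case using digit_sum_add_power_le[OF q_ge_2, of i j] Suc.IH[OF i(2)] by simp
  qed (use that in simp)
  show ?case
  proof (cases "d = 0")
    case True
    thus ?thesis using less.prems by (simp split: if_splits)
  next
    case False
    hence "d' < d" unfolding d'_def using q_ge_2 by simp
    have "digit_sum q k \<le> digit_sum q d' + r"
    proof (rule step)
      show "((S ^ d') ^ q * S ^ r) $ k \<noteq> 0"
        using less.prems unfolding d S_def by (simp add: power_add power_mult mult.commute)
    next
      fix k assume "((S ^ d') ^ q) $ k \<noteq> 0"
      hence *: "q dvd k" "(S ^ d') $ (k div q) \<noteq> 0"
        using q_ge_2 by (auto simp: fps_power_q_nth split: if_splits)
      hence "k = q * (k div q) + 0" by simp
      hence "digit_sum q k = digit_sum q (k div q)"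
        using digit_sum_mult_add[of 0 q "k div q"] q_ge_2 by simp
      thus "digit_sum q k \<le> digit_sum q d'"
        using less.IH[OF \<open>d' < d\<close>] * by (simp add: S_def)
    qed
    thus ?thesis using digit_sum_mult_add[OF r q_ge_2, of d'] d by simp
  qed
qed

lemma fps_compose_qlin_series_nth:
  assumes "a 0 = 1"
  shows   "(f oo (qlin_series q a :: 'b fps)) $ (q ^ n - 1) = f $ (q ^ n - 1)"
proof -
  define S where "S = (qlin_series q a :: 'b fps)"
  have S0: "S $ 0 = 0" and S1: "S $ 1 = 1"
    using q_ge_2 assms qlin_series_nth_power[OF q_ge_2, of a 0] by (auto simp: S_def)
  \<comment> \<open>A nonzero coefficient would force
    \<open>n * (q - 1) \<le> digit_sum q d\<close>, too much for
    \<open>d < q ^ n - 1\<close>.\<close>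
  have "(S ^ d) $ (q ^ n - 1) = 0" if "d < q ^ n - 1" for d
    using digit_sum_le_of_qlin_series_power_nth[of a d "q ^ n - 1"] digit_sum_less[OF q_ge_2 that]
      digit_sum_power_minus_1[OF q_ge_2, of n] by (auto simp: S_def)
  moreover have "(S ^ k) $ k = 1" for k
    using startsby_zero_power_nth_same[OF S0, of k] S1 by simp
  ultimately have "(f oo S) $ (q ^ n - 1) = (\<Sum>d=0..q ^ n - 1. if d = q ^ n - 1 then f $ d else 0)"
    unfolding fps_compose_nth by (intro sum.cong) auto
  thus ?thesis by (simp add: S_def)
qed

section \<open>Partial coefficient sums of a power of an additive series\<close>

lemma qlin_series_prod_partial_sum:
  assumes "1 \<le> n" "(\<Sum>i<n. N i) \<le> q - 1"
  shows "(\<Sum>k\<le>q ^ n - 1. ((qlin_series q l :: 'b fps) ^ (\<Sum>i<n. N i * q ^ i)) $ k) =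
         (\<Prod>i<n. (\<Sum>j<n - i. l j) ^ (N i * q ^ i))"
proof -
  \<comment> \<open>\<open>Q i\<close> is \<open>qlin_series q l ^ (q ^ i)\<close> without its terms
    of exponent \<open>q ^ n\<close> or more; this is the bound \<open>j < n - i\<close>.\<close>
  define Q where "Q i = (\<Sum>j<n - i. monom (l j ^ (q ^ i)) (q ^ (i + j)))" for i
  define P where "P = (\<Prod>i<n. Q i ^ N i)"
  have pos: "q ^ n > 0" using q_ge_2 by simp
  have Q_nth: "(qlin_series q l ^ (q ^ i)) $ k = fps_of_poly (Q i) $ k" if "i < n" "k < q ^ n" for i k
  proof (cases "k \<in> range (\<lambda>j. q ^ j)")
    case True
    then obtain m where k: "k = q ^ m" by auto
    have "m < n" using that(2) q_ge_2 k by simp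
    have "coeff (Q i) k = (\<Sum>j<n - i. if i + j = m then l j ^ (q ^ i) else 0)"
      using q_ge_2 by (simp add: Q_def coeff_sum k)
    also have "\<dots> = (\<Sum>j<n - i. if j = m - i \<and> i \<le> m then l j ^ (q ^ i) else 0)"
      by (intro sum.cong) auto
    also have "\<dots> = (if m < i then 0 else l (m - i) ^ (q ^ i))"
      using \<open>m < n\<close> by (cases "i \<le> m") auto
    finally show ?thesis using q_ge_2 by (simp add: qlin_series_power_q_power k)
  next
    case False
    hence "coeff (Q i) k = 0" by (auto simp: Q_def coeff_sum intro!: sum.neutral)
    thus ?thesis using False by (simp add: qlin_series_power_q_power qlin_series_nth_eq_0)
  qed
  have P_nth: "(qlin_series q l ^ (\<Sum>i<n. N i * q ^ i)) $ k = coeff P k" if "k < q ^ n" for k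
  proof -
    have "qlin_series q l ^ (\<Sum>i<n. N i * q ^ i) = (\<Prod>i<n. (qlin_series q l ^ (q ^ i)) ^ N i)"
      by (simp add: power_sum mult.commute flip: power_mult)
    also have "\<dots> $ k = (\<Prod>i<n. fps_of_poly (Q i) ^ N i) $ k"
      using that by (intro fps_prod_nth_cong[where M = "q ^ n"] fps_power_nth_cong[where M = "q ^ n"] Q_nth) auto
    also have "\<dots> = coeff P k"
      unfolding P_def by (simp flip: fps_of_poly_power fps_of_poly_prod)
    finally show ?thesis .
  qed
  have deg_Q: "degree (Q i) \<le> q ^ (n - 1)" for i
  proof -
    have "degree (monom (l j ^ (q ^ i)) (q ^ (i + j))) \<le> q ^ (n - 1)" if "j < n - i" for j
      using q_ge_2 that by (intro order.trans[OF degree_monom_le] power_increasing) auto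
    thus ?thesis unfolding Q_def by (intro degree_sum_le) auto
  qed
  \<comment> \<open>At most \<open>q - 1\<close> factors of degree at most
    \<open>q ^ (n - 1)\<close> keep the degree below \<open>q ^ n\<close>, so the partial sum covers
    all coefficients of \<open>P\<close> and equals its value at \<open>1\<close>.\<close>
  have "degree P \<le> (\<Sum>i<n. degree (Q i ^ N i))"
    unfolding P_def by (rule order.trans[OF degree_prod_sum_le]) (auto simp: comp_def)
  also have "\<dots> \<le> (\<Sum>i<n. N i * q ^ (n - 1))"
    by (intro sum_mono order.trans[OF degree_power_le])
       (use deg_Q in \<open>auto simp: mult.commute\<close>)
  also have "\<dots> \<le> (q - 1) * q ^ (n - 1)"
    using assms(2) by (simp flip: sum_distrib_right)
  also have "\<dots> = q ^ n - q ^ (n - 1)"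
    using assms(1) by (cases n) (auto simp: algebra_simps)
  also have "\<dots> \<le> q ^ n - 1"
  proof -
    have "q ^ (n - 1) \<ge> 1" using q_ge_2 by simp
    thus ?thesis by linarith
  qed
  finally have deg_P: "degree P \<le> q ^ n - 1" .
  have "(\<Sum>k\<le>q ^ n - 1. (qlin_series q l ^ (\<Sum>i<n. N i * q ^ i)) $ k) = (\<Sum>k\<le>q ^ n - 1. coeff P k)"
  proof (intro sum.cong P_nth)
    fix k assume "k \<in> {..q ^ n - 1}"
    hence "k \<le> q ^ n - 1" by simp
    thus "k < q ^ n" using pos by linarith
  qed simp
  also have "\<dots> = poly P 1"
    unfolding poly_altdef using deg_P
    by (simp, intro sum.mono_neutral_right) (auto simp: coeff_eq_0)
  \<comment> \<open>At \<open>1\<close>, \<open>Q i\<close> is a sum of powers \<open>q ^ i\<close>,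
    which additivity turns into the power \<open>q ^ i\<close> of the sum.\<close>
  also have "\<dots> = (\<Prod>i<n. (\<Sum>j<n - i. l j) ^ (N i * q ^ i))"
    by (simp add: P_def Q_def poly_prod poly_sum poly_monom mult.commute
          flip: sum_power_q_power power_mult)
  finally show ?thesis .
qed

text \<open>Ensures that \<open>q ^ n - (\<Sum>i<n. N i * q ^ i)\<close> is positive, so that the
  index one below it is a genuine difference.\<close>

lemma sum_nat_digits_less:
  assumes "1 \<le> n" "(\<Sum>i<n. N i) \<le> q - 1"
  shows   "(\<Sum>i<n. N i * q ^ i) < q ^ n"
proof -
  have "(\<Sum>i<n. N i * q ^ i) \<le> (\<Sum>i<n. N i * q ^ (n - 1))"
    using q_ge_2 by (intro sum_mono mult_left_mono power_increasing) auto
  also have "\<dots> \<le> (q - 1) * q ^ (n - 1)"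
    using assms(2) by (simp flip: sum_distrib_right)
  also have "\<dots> < q * q ^ (n - 1)"
    using q_ge_2 by simp
  also have "\<dots> = q ^ n" using assms(1) by (cases n) auto
  finally show ?thesis .
qed

text \<open>Only the powers \<open>q ^ i\<close> of the inner series enter, and these are shifted
  and twisted by Frobenius; the result is multiplication of skew power series.\<close>

lemma qlin_series_compose:
  "(qlin_series q l :: 'b fps) oo qlin_series q a =
     qlin_series q (\<lambda>k. \<Sum>i\<le>k. l i * a (k - i) ^ (q ^ i))" (is "_ = qlin_series q ?c")
proof (rule fps_ext)
  fix k
  have inj: "inj_on (\<lambda>i. q ^ i) A" for A using q_ge_2 by (auto intro: inj_onI)
  have nth: "((qlin_series q a :: 'b fps) ^ (q ^ i)) $ k =
          qlin_series q (\<lambda>j. if j < i then 0 else a (j - i) ^ (q ^ i)) $ k" for i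
    by (simp only: qlin_series_power_q_power)
  have "(qlin_series q l oo qlin_series q a) $ k =
          (\<Sum>d\<in>(\<lambda>i. q ^ i) ` {i. q ^ i \<le> k}. qlin_series q l $ d * (qlin_series q a ^ d) $ k)"
    unfolding fps_compose_nth
    by (rule sum.mono_neutral_right) (auto intro!: qlin_series_nth_eq_0)
  also have "\<dots> = (\<Sum>i | q ^ i \<le> k. l i * (qlin_series q a ^ (q ^ i)) $ k)"
    using q_ge_2 by (simp add: sum.reindex[OF inj])
  also have "\<dots> = qlin_series q ?c $ k"
  proof (cases "k \<in> range (\<lambda>i. q ^ i)")
    case True
    then obtain m where k: "k = q ^ m" by auto
    have "{i. q ^ i \<le> k} = {..m}" using q_ge_2 by (auto simp: k)
    thus ?thesis using q_ge_2 by (simp add: qlin_series_power_q_power k)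
  next
    case False
    thus ?thesis by (simp add: nth qlin_series_nth_eq_0)
  qed
  finally show "(qlin_series q l oo qlin_series q a) $ k = qlin_series q ?c $ k" .
qed

lemma inverse_one_minus_qlin_series_nth:
  assumes "1 \<le> n" "(\<Sum>i<n. N i) \<le> q - 1" "a 0 = 1"
    and inv: "(qlin_series q l :: 'b fps) oo qlin_series q a = fps_X"
  shows "inverse (1 - qlin_series q a :: 'b fps) $ (q ^ n - (\<Sum>i<n. N i * q ^ i) - 1) =
         (\<Prod>i<n. (\<Sum>j<n - i. l j) ^ (N i * q ^ i))"
proof -
  define E where "E = (\<Sum>i<n. N i * q ^ i)"
  define S where "S = (qlin_series q a :: 'b fps)"
  define Y where "Y = (qlin_series q l :: 'b fps)"
  have S0: "S $ 0 = 0" using q_ge_2 by (simp add: S_def)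
  have E: "E < q ^ n" unfolding E_def by (rule sum_nat_digits_less) fact+
  have "inverse (1 - S) = inverse (1 - fps_X) oo S"
    using S0 by (subst fps_inverse_compose) (auto simp: fps_compose_sub_distrib)
  moreover have "fps_X ^ E = Y ^ E oo S"
    using inv S0 by (simp add: fps_compose_power S_def Y_def flip: fps_compose_power)
  ultimately have eq: "fps_X ^ E * inverse (1 - S) = (Y ^ E * inverse (1 - fps_X)) oo S"
    by (simp add: fps_compose_mult_distrib[OF S0])
  \<comment> \<open>Multiplication by \<open>fps_X ^ E\<close> moves the wanted index to
    \<open>q ^ n - 1\<close>, where composition with \<open>S\<close> leaves the coefficient
    unchanged.\<close>
  have "inverse (1 - S) $ (q ^ n - E - 1) = (fps_X ^ E * inverse (1 - S)) $ (q ^ n - 1)"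
    using E by (simp add: fps_X_power_mult_nth)
  also have "\<dots> = (Y ^ E * inverse (1 - fps_X)) $ (q ^ n - 1)"
    unfolding eq unfolding S_def by (rule fps_compose_qlin_series_nth) fact
  also have "\<dots> = (\<Sum>k\<le>q ^ n - 1. (Y ^ E) $ k)"
    by (rule fps_mult_inverse_one_minus_X_nth)
  also have "\<dots> = (\<Prod>i<n. (\<Sum>j<n - i. l j) ^ (N i * q ^ i))"
    unfolding Y_def E_def by (rule qlin_series_prod_partial_sum) fact+
  finally show ?thesis by (simp add: S_def E_def)
qed

end

section \<open>The telescoping identity behind the compositional inverse\<close>

text \<open>
  Applied with \<open>u j = t ^ (q ^ j)\<close> and \<open>v j = \<theta> ^ (q ^ j)\<close>: the factor next to \<open>l i\<close> is then
  \<open>a\<^sub>k\<^sub>-\<^sub>i ^ (q ^ i)\<close>, and the sum is the coefficient of \<open>x ^ (q ^ k)\<close> in \<open>\<lambda>(S(x))\<close>.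
\<close>

lemma telescoping_sum_eq_0:
  fixes u v :: "nat \<Rightarrow> 'b::field"
  defines "c \<equiv> \<lambda>k. \<Prod>j=1..k. (u 0 - v j) / (u 0 - u j)"
  defines "l \<equiv> \<lambda>k. if k = 0 then 1 else c k - c (k - 1)"
  assumes "0 < k" and u: "inj u"
  shows   "(\<Sum>i\<le>k. l i * ((\<Prod>s=Suc i..k. u k - v s) / (\<Prod>s=i..<k. u k - u s))) = 0"
proof -
  define B where "B i = (\<Prod>s=Suc i..k. u k - v s) / (\<Prod>s=i..<k. u k - u s)" for i
  have ne: "u i - u j \<noteq> 0" if "i \<noteq> j" for i j
    using u that by (auto dest: injD)
  have c_Suc: "c (Suc k) = c k * ((u 0 - v (Suc k)) / (u 0 - u (Suc k)))" for k
    by (simp add: c_def)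
  have l_Suc: "l (Suc k) = c k * ((u (Suc k) - v (Suc k)) / (u 0 - u (Suc k)))" for k
    using ne[of 0 "Suc k"] by (simp add: l_def c_Suc field_simps)
  \<comment> \<open>Closed form valid for \<open>r < k\<close>. At \<open>r = k - 1\<close> it is
    the negative of the last term \<open>l k\<close>, which finishes the proof.\<close>
  have partial: "(\<Sum>i\<le>r. l i * B i) =
      c r * (\<Prod>s=Suc r..k. u k - v s) / ((u k - u 0) * (\<Prod>s=Suc r..<k. u k - u s))" if "r < k" for r
    using that
  proof (induction r)
    case 0
    thus ?case by (simp add: l_def c_def B_def prod.atLeast_Suc_lessThan)
  next
    case (Suc r)
    define V U where "V = (\<Prod>s=Suc (Suc r)..k. u k - v s)" and "U = (\<Prod>s=Suc (Suc r)..<k. u k - u s)"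
    have V: "(\<Prod>s=Suc r..k. u k - v s) = (u k - v (Suc r)) * V"
      using Suc.prems by (simp add: V_def prod.atLeast_Suc_atMost)
    have U: "(\<Prod>s=Suc r..<k. u k - u s) = (u k - u (Suc r)) * U"
      using Suc.prems by (simp add: U_def prod.atLeast_Suc_lessThan)
    have ne': "u k - u (Suc r) \<noteq> 0" "u 0 - u (Suc r) \<noteq> 0" "u k - u 0 \<noteq> 0"
      using Suc.prems by (intro ne; simp)+
    \<comment> \<open>Addition of two fractions whose common factor
      \<open>w = u k - u (Suc r)\<close> cancels; here \<open>z = u k - u 0\<close> and
      \<open>p = u 0 - u (Suc r)\<close>.\<close>
    have key: "x / (z * w) + y / (p * w) = b / (z * p)"
      if "z \<noteq> 0" "w \<noteq> 0" "p \<noteq> 0" "x * p + y * z = b * w" for x y z w p b :: 'b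
    proof -
      have "x / (z * w) + y / (p * w) = (x * p + y * z) / (z * w * p)"
        using that(1-3) by (simp add: field_simps)
      thus ?thesis using that by simp
    qed
    have "(\<Sum>i\<le>Suc r. l i * B i) = c r * ((u k - v (Suc r)) * V) / ((u k - u 0) * ((u k - u (Suc r)) * U)) +
        c r * ((u (Suc r) - v (Suc r)) / (u 0 - u (Suc r))) * (V / ((u k - u (Suc r)) * U))"
      using Suc by (simp add: l_Suc B_def U V flip: V_def)
    also have "\<dots> = c r * (V / U) * ((u k - v (Suc r)) / ((u k - u 0) * (u k - u (Suc r))) +
        (u (Suc r) - v (Suc r)) / ((u 0 - u (Suc r)) * (u k - u (Suc r))))"
      by (simp add: distrib_left mult_ac)
    also have "(u k - v (Suc r)) / ((u k - u 0) * (u k - u (Suc r))) +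
        (u (Suc r) - v (Suc r)) / ((u 0 - u (Suc r)) * (u k - u (Suc r))) =
        (u 0 - v (Suc r)) / ((u k - u 0) * (u 0 - u (Suc r)))"
      using ne' by (intro key) (auto simp: algebra_simps)
    finally show ?case
      by (simp add: c_Suc mult_ac flip: V_def U_def)
  qed
  obtain r where k: "k = Suc r" using \<open>0 < k\<close> by (cases k) auto
  have "(\<Sum>i\<le>k. l i * B i) = c r * (u k - v k) / (u k - u 0) + l k"
    using partial[of r] by (simp add: k B_def)
  also have "\<dots> = 0"
    using ne[of 0 k] ne[of k 0] k by (simp add: l_Suc field_simps)
  finally show ?thesis by (simp add: B_def)
qed

lemma sum_differences_eq:
  fixes c :: "nat \<Rightarrow> 'b::comm_ring_1"
  assumes "c 0 = 1"
  shows   "(\<Sum>j<Suc k. if j = 0 then 1 else c j - c (j - 1)) = c k"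
  using assms by (induction k) auto

section \<open>Transfer to the fraction field of \<open>A[t]\<close>\<close>

lemma to_fract_power: "to_fract (x ^ n) = to_fract x ^ n"
  by (induction n) auto

lemma to_fract_prod: "to_fract (prod f A) = (\<Prod>x\<in>A. to_fract (f x))"
  by (induction A rule: infinite_finite_induct) auto

lemma of_nat_eq_to_fract: "of_nat k = to_fract (of_nat k)"
  by (induction k) auto

lemma subst_t_theta: "subst_t theta = var_t"
  by (simp add: subst_t_def theta_def var_t_def map_poly_pCons)

lemma subst_t_power: "subst_t (f ^ n) = subst_t f ^ n"
  by (induction n) (auto simp: subst_t_mult)

lemma subst_t_diff: "subst_t (f - g) = subst_t f - subst_t g"
  by (rule poly_eqI) (simp add: subst_t_def coeff_map_poly)

lemma subst_t_prod: "subst_t (prod f A) = (\<Prod>x\<in>A. subst_t (f x))"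
  by (induction A rule: infinite_finite_induct) (auto simp: subst_t_mult)

lemma frobenius_field_fract: "frobenius_field TYPE('a::finite_field poly poly fract) CARD('a)"
proof
  fix k assume "0 < k" "k < CARD('a)"
  thus "of_nat (CARD('a) choose k) = (0 :: 'a poly poly fract)"
    by (simp add: of_nat_eq_to_fract of_nat_poly binomial_CARD_eq_0)
qed (rule card_finite_field_ge_2)

text \<open>Both sides run over the triangle \<open>1 \<le> j\<close>, \<open>i + j \<le> n\<close>,
  in the two orders.\<close>

lemma triangular_prod_power:
  fixes f :: "nat \<Rightarrow> 'b::comm_semiring_1"
  shows "(\<Prod>i=0..<n. (\<Prod>j=1..n-i. f j) ^ e i) = (\<Prod>j=1..n. f j ^ (\<Sum>i=0..n-j. e i))"
proof -
  have "(\<Prod>i=0..<n. (\<Prod>j=1..n-i. f j) ^ e i) =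
          (\<Prod>i=0..<n. \<Prod>j | j \<in> {1..n} \<and> i + j \<le> n. f j ^ e i)"
  proof (intro prod.cong refl)
    fix i assume "i \<in> {0..<n}"
    hence "{j. j \<in> {1..n} \<and> i + j \<le> n} = {1..n-i}" by auto
    thus "(\<Prod>j=1..n-i. f j) ^ e i = (\<Prod>j | j \<in> {1..n} \<and> i + j \<le> n. f j ^ e i)"
      by (simp only: prod_power_distrib)
  qed
  also have "\<dots> = (\<Prod>j=1..n. \<Prod>i | i \<in> {0..<n} \<and> i + j \<le> n. f j ^ e i)"
    by (rule prod.swap_restrict) auto
  also have "\<dots> = (\<Prod>j=1..n. f j ^ (\<Sum>i=0..n-j. e i))"
    unfolding power_sum by (intro prod.cong) auto
  finally show ?thesis .
qed

theorem theorem3p2: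
  fixes n m :: nat and N :: "nat \<Rightarrow> nat"
  assumes "n \<ge> 1"
    and "(\<Sum>i=0..<n. N i) \<le> CARD('a::finite_field) - 1"
    and "m = CARD('a) ^ n - (\<Sum>i=0..<n. N i * CARD('a) ^ i)"
  shows "to_fract (AT_H (m - 1) :: 'a poly poly) / to_fract (subst_t (carlitz_Gamma m)) =
    (-1) ^ (\<Sum>i=0..<n-1. (n - 1 - i) * N i * CARD('a) ^ i)
    / (\<Prod>i=0..<n-1. to_fract (subst_t (carlitz_L (n - 1 - i))) ^ (N i * CARD('a) ^ i))
    * (\<Prod>i=1..n-1. to_fract (var_t - [:theta ^ (CARD('a) ^ i):]) ^ (\<Sum>j=0..n-1-i. N j * CARD('a) ^ j))"
proof -
  define q where "q = CARD('a)"
  interpret frobenius_field q "TYPE('a poly poly fract)"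
    unfolding q_def by (rule frobenius_field_fract)
  define u v :: "nat \<Rightarrow> 'a poly poly fract"
    where "u j = to_fract (var_t ^ (q ^ j))" and "v j = to_fract [:theta ^ (q ^ j):]" for j
  \<comment> \<open>\<open>c\<close> is the expected sequence of partial sums of the inverse series
    and \<open>l\<close> its differences. The partial sums are then correct by construction, and it
    remains to check that \<open>l\<close> gives an inverse.\<close>
  define c where "c k = (\<Prod>j=1..k. (u 0 - v j) / (u 0 - u j))" for k
  define l where "l k = (if k = 0 then 1 else c k - c (k - 1))" for k
  define a :: "nat \<Rightarrow> 'a poly poly fract"
    where "a i = to_fract (AT_G i) / to_fract (subst_t (carlitz_D i))" for i
  have sums: "(\<Sum>i<n. N i) \<le> q - 1" "m = q ^ n - (\<Sum>i<n. N i * q ^ i)"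
    using assms(2,3) by (simp_all add: q_def atLeast0LessThan)
  \<comment> \<open>The degrees in \<open>t\<close> are distinct powers of \<open>q\<close>; the
    telescoping identity divides by differences of the \<open>u j\<close>.\<close>
  have u: "inj u"
  proof (rule injI)
    fix i j assume "u i = u j"
    hence "degree ((var_t :: 'a poly poly) ^ (q ^ i)) = degree ((var_t :: 'a poly poly) ^ (q ^ j))"
      by (simp add: u_def)
    thus "i = j" using q_ge_2 by (simp add: var_t_def degree_power_eq)
  qed
  have u_power: "u j ^ (q ^ i) = u (j + i)" and v_power: "v j ^ (q ^ i) = v (j + i)" for i j
    by (simp_all add: u_def v_def power_add poly_const_pow flip: to_fract_power power_mult)
  have a_eq: "a i = (\<Prod>s=1..i. u i - v s) / (\<Prod>s<i. u i - u s)" for i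
    by (simp add: a_def AT_G_def carlitz_D_def subst_t_prod subst_t_diff subst_t_power
          subst_t_theta to_fract_prod u_def v_def q_def)
  have a_power: "a (k - i) ^ (q ^ i) = (\<Prod>s=Suc i..k. u k - v s) / (\<Prod>s=i..<k. u k - u s)"
    if "i \<le> k" for i k
  proof -
    have "a (k - i) ^ (q ^ i) = (\<Prod>s=1..k-i. u k - v (s + i)) / (\<Prod>s=0..<k-i. u k - u (s + i))"
      using that by (simp add: a_eq power_divide prod_power_distrib diff_power_q_power u_power v_power
                      atLeast0LessThan)
    also have "(\<Prod>s=1..k-i. u k - v (s + i)) = (\<Prod>s=Suc i..k. u k - v s)"
      using that prod.shift_bounds_cl_nat_ivl[of "\<lambda>s. u k - v s" 1 i "k - i"] by simp
    also have "(\<Prod>s=0..<k-i. u k - u (s + i)) = (\<Prod>s=i..<k. u k - u s)"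
      using that prod.shift_bounds_nat_ivl[of "\<lambda>s. u k - u s" 0 i "k - i"] by simp
    finally show ?thesis .
  qed
  have a0: "a 0 = 1" by (simp add: a_eq)
  have coeff_inv: "(\<Sum>i\<le>k. l i * a (k - i) ^ (q ^ i)) = (if k = 0 then 1 else 0)" for k
  proof (cases "k = 0")
    case False
    hence "(\<Sum>i\<le>k. l i * ((\<Prod>s=Suc i..k. u k - v s) / (\<Prod>s=i..<k. u k - u s))) = 0"
      unfolding l_def c_def by (intro telescoping_sum_eq_0[OF _ u]) simp
    thus ?thesis using False by (simp add: a_power)
  qed (simp add: l_def a0)
  have inv: "qlin_series q l oo qlin_series q a = fps_X"
  proof (rule fps_ext)
    fix k
    show "(qlin_series q l oo qlin_series q a) $ k = fps_X $ k"
    proof (cases "k \<in> range (\<lambda>i. q ^ i)")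
      case True
      then obtain j where "k = q ^ j" by auto
      thus ?thesis using q_ge_2 by (simp add: qlin_series_compose coeff_inv)
    next
      case False
      moreover from this have "k \<noteq> 1" by (metis power_0 rangeI)
      ultimately show ?thesis
        by (simp add: qlin_series_compose qlin_series_nth_eq_0)
    qed
  qed
  have sum_l: "(\<Sum>j<n - i. l j) = c (n - 1 - i)" if "i < n" for i
  proof -
    have "n - i = Suc (n - 1 - i)" using that by simp
    moreover have "c 0 = 1" by (simp add: c_def)
    ultimately show ?thesis unfolding l_def by (simp only: sum_differences_eq)
  qed
  have L: "to_fract (subst_t (carlitz_L k)) = (\<Prod>j=1..k. u j - u 0)" for k
    by (simp add: carlitz_L_def carlitz_bracket_def subst_t_prod subst_t_diff subst_t_power
          subst_t_theta to_fract_prod u_def q_def)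
  \<comment> \<open>The sign comes from reversing the \<open>k\<close> differences
    \<open>u 0 - u j\<close> to match the brackets in \<open>carlitz_L k\<close>.\<close>
  have c_eq: "c k = (-1) ^ k / to_fract (subst_t (carlitz_L k)) * (\<Prod>j=1..k. u 0 - v j)" for k
  proof -
    have "(\<Prod>j=1..k. u 0 - u j) = (\<Prod>j=1..k. (-1) * (u j - u 0))"
      by (intro prod.cong) auto
    also have "\<dots> = (-1) ^ k * (\<Prod>j=1..k. u j - u 0)"
      unfolding prod.distrib by simp
    finally show ?thesis
      by (simp add: c_def L prod_dividef divide_simps)
  qed
  have "to_fract (AT_H (m - 1) :: 'a poly poly) / to_fract (subst_t (carlitz_Gamma m)) =
        inverse (1 - AT_series :: 'a poly poly fract fps) $ (m - 1)"
  proof -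
    \<comment> \<open>Positivity gives \<open>m - 1 + 1 = m\<close>, matching the index of
      \<open>carlitz_Gamma\<close> in the generating function.\<close>
    have "m > 0" using sum_nat_digits_less[OF assms(1) sums(1)] sums(2) by simp
    thus ?thesis by (simp add: AT_H_generating_function)
  qed
  also have "AT_series = qlin_series q a"
    by (simp add: AT_series_def qlin_series_def a_def q_def)
  also have "inverse (1 - qlin_series q a) $ (m - 1) = (\<Prod>i<n. (\<Sum>j<n - i. l j) ^ (N i * q ^ i))"
    unfolding sums(2) by (rule inverse_one_minus_qlin_series_nth[OF assms(1) sums(1) a0 inv])
  also have "\<dots> = (\<Prod>i<n. c (n - 1 - i) ^ (N i * q ^ i))"
    by (intro prod.cong) (auto simp: sum_l)
  \<comment> \<open>The factor for \<open>i = n - 1\<close> is a power of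
    \<open>c 0 = 1\<close>.\<close>
  also have "\<dots> = (\<Prod>i=0..<n-1. c (n - 1 - i) ^ (N i * q ^ i))"
    using assms(1) by (cases n) (auto simp: c_def atLeast0LessThan)
  also have "\<dots> = (\<Prod>i=0..<n-1. ((-1) ^ (n - 1 - i)) ^ (N i * q ^ i)) /
      (\<Prod>i=0..<n-1. to_fract (subst_t (carlitz_L (n - 1 - i))) ^ (N i * q ^ i)) *
      (\<Prod>i=0..<n-1. (\<Prod>j=1..n-1-i. u 0 - v j) ^ (N i * q ^ i))"
    unfolding c_eq power_mult_distrib power_divide prod.distrib prod_dividef ..
  also have "(\<Prod>i=0..<n-1. ((-1) ^ (n - 1 - i)) ^ (N i * q ^ i)) =
      ((-1) ^ (\<Sum>i=0..<n-1. (n - 1 - i) * N i * q ^ i) :: 'a poly poly fract)"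
    unfolding power_sum by (simp only: power_mult mult.assoc)
  also have "(\<Prod>i=0..<n-1. (\<Prod>j=1..n-1-i. u 0 - v j) ^ (N i * q ^ i)) =
      (\<Prod>j=1..n-1. (u 0 - v j) ^ (\<Sum>i=0..n-1-j. N i * q ^ i))"
    by (rule triangular_prod_power)
  finally show ?thesis
    by (simp add: u_def v_def q_def)
qed

end
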